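(* Let $\lambda$ be any panel distribution of a sortition instance with $n$ pool members, let $m\ge1$, and create a transparent lottery consisting of $m$ panels drawn independently from $\lambda$. Then, for any $0<\delta<1$, with probability at least $1-\delta$ the selection probabilities $\hat\pi$ of the transparent lottery satisfy $$\|\hat\pi-\pi_\lambda\|_\infty\le\sqrt{\frac{\ln(2n)+\ln(\delta^{-1})}{2m}}.$$
   Context: The pool is $N=\{1,\dots,n\}$, $\mathcal P$ is the nonempty finite set of panels (certain subsets of $N$ of size $k$, namely those satisfying given quotas), and a panel distribution is a probability distribution $\lambda$ on $\mathcal P$. Its selection probabilities are $\pi_\lambda(i)=\Pr_{P\sim\lambda}[i\in P]$ for $i\in N$. A transparent lottery is a list $P_1,\dots,P_m$ of panels (possibly with repetitions), from which the final panel is drawn uniformly; its selection probabilities are $\hat\pi(i)=\frac1m|\{t\in\{1,\dots,m\}: i\in P_t\}|$ for $i\in N$. *)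

theory Defs
  imports "HOL-Probability.Probability"
begin

record ('f, 'v) sortition_instance =
  pool_size :: nat
  panel_size :: nat
  features :: "'f set"
  feature_vals :: "'f \<Rightarrow> 'v set"
  feature_of :: "'f \<Rightarrow> nat \<Rightarrow> 'v"
  lower_quota :: "'f \<Rightarrow> 'v \<Rightarrow> nat"
  upper_quota :: "'f \<Rightarrow> 'v \<Rightarrow> nat"

definition pool :: "('f, 'v) sortition_instance \<Rightarrow> nat set" where
  "pool I = {1..pool_size I}"

definition panels :: "('f, 'v) sortition_instance \<Rightarrow> nat set set" where
  "panels I = {P. P \<subseteq> pool I \<and> card P = panel_size I \<and>
     (\<forall>f\<in>features I. \<forall>v\<in>feature_vals I f.
        lower_quota I f v \<le> card {i\<in>P. feature_of I f i = v} \<and>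
        card {i\<in>P. feature_of I f i = v} \<le> upper_quota I f v)}"

definition is_sortition_instance :: "('f, 'v) sortition_instance \<Rightarrow> bool" where
  "is_sortition_instance I \<longleftrightarrow>
     1 \<le> pool_size I \<and>
     finite (features I) \<and>
     (\<forall>f\<in>features I. finite (feature_vals I f) \<and>
        (\<forall>i\<in>pool I. feature_of I f i \<in> feature_vals I f)) \<and>
     panels I \<noteq> {}"

definition panel_distribution :: "('f, 'v) sortition_instance \<Rightarrow> nat set pmf \<Rightarrow> bool" where
  "panel_distribution I lam \<longleftrightarrow> set_pmf lam \<subseteq> panels I"

definition selection_prob :: "nat set pmf \<Rightarrow> nat \<Rightarrow> real" where
  "selection_prob lam i = measure_pmf.prob lam {P. i \<in> P}"

text \<open>
  A transparent lottery is the list of its panels. List positions start at 0, so the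
  panel written \<open>P\<^sub>t\<close> with \<open>t \<in> {1..m}\<close> is \<open>Ps ! (t - 1)\<close>.
\<close>

definition lottery_selection_prob :: "nat set list \<Rightarrow> nat \<Rightarrow> real" where
  "lottery_selection_prob Ps i =
     1 / real (length Ps) * real (card {t\<in>{1..length Ps}. i \<in> Ps ! (t - 1)})"

text \<open>
  The maximum norm of a vector indexed by the pool members \<open>1, \<dots>, n\<close>; only meaningful
  for \<open>n \<ge> 1\<close>, since \<^const>\<open>Max\<close> is unspecified on the empty set.
\<close>

definition linf_norm :: "nat \<Rightarrow> (nat \<Rightarrow> real) \<Rightarrow> real" where
  "linf_norm n x = Max ((\<lambda>i. \<bar>x i\<bar>) ` {1..n})"

end

theory Submission
  imports Defs
begin

text \<open>
  For each pool member the selection probability in the lottery is the empirical mean of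
  $m$ independent Bernoulli variables with mean $\pi_\lambda(i)$, so Hoeffding's inequality bounds the
  probability of a deviation by more than $\varepsilon$ by $2 \exp(-2 m \varepsilon^2)$. The
  stated $\varepsilon$ makes this equal to $\delta / n$, and a union bound over the
  $n$ pool members concludes.
\<close>

text \<open>The list holds \<open>Q t\<close> at position \<open>t - 1\<close>, so the shift in the
  definition cancels and a plain empirical frequency remains.\<close>

lemma lottery_selection_prob_map:
  "lottery_selection_prob (map Q [1..<Suc m]) i = real (card {t\<in>{1..m}. i \<in> Q t}) / real m"
proof -
  have "{t\<in>{1..m}. i \<in> map Q [1..<Suc m] ! (t - 1)} = {t\<in>{1..m}. i \<in> Q t}"
    by (auto simp del: upt_Suc)
  thus ?thesis
    by (simp add: lottery_selection_prob_def del: upt_Suc)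
qed

text \<open>A nonempty index set makes \<open>Max\<close> a true maximum. This splits the norm bound
  into one event per pool member, as the union bound requires.\<close>

lemma linf_norm_le_iff:
  assumes "n \<ge> 1"
  shows "linf_norm n x \<le> c \<longleftrightarrow> (\<forall>i\<in>{1..n}. \<bar>x i\<bar> \<le> c)"
  using assms by (auto simp: linf_norm_def)

context prob_space
begin

text \<open>The count is a finite sum of indicators, each composed with a measurable
  \<open>X t\<close> into a discrete space. This makes the deviation sets events.\<close>

lemma borel_measurable_card_hits:
  assumes "finite T"
    and "\<And>t. t \<in> T \<Longrightarrow> X t \<in> measurable M (count_space UNIV)"
  shows "(\<lambda>\<omega>. real (card {t\<in>T. X t \<omega> \<in> A})) \<in> borel_measurable M"
proof -
  have "(\<lambda>\<omega>. \<Sum>t\<in>T. indicat_real A (X t \<omega>)) \<in> borel_measurable M"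
    by (intro borel_measurable_sum measurable_compose[OF assms(2)]) auto
  thus ?thesis
    using assms(1) by (simp add: indicator_def sum.If_cases Int_def)
qed

text \<open>Indicators of \<open>A\<close> applied to independent variables stay independent, lie in
  [0,1] and have common mean \<open>measure_pmf.prob p A\<close>, so Hoeffding's inequality applies
  to their sum.\<close>

lemma Hoeffding_empirical_frequency:
  fixes p :: "'c pmf"
  assumes fin: "finite T" and ne: "T \<noteq> {}"
    and indep: "indep_vars (\<lambda>_. count_space UNIV) X T"
    and distr: "\<And>t. t \<in> T \<Longrightarrow> distr M (count_space UNIV) (X t) = measure_pmf p"
    and "\<epsilon> \<ge> 0"
  shows "prob {\<omega>\<in>space M. \<bar>real (card {t\<in>T. X t \<omega> \<in> A}) / real (card T) - measure_pmf.prob p A\<bar> \<ge> \<epsilon>}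
           \<le> 2 * exp (-2 * real (card T) * \<epsilon>\<^sup>2)"
proof -
  define m where "m = real (card T)"
  have m: "m > 0"
    using fin ne by (simp add: m_def card_gt_0_iff)
  define Y where "Y = (\<lambda>t \<omega>. indicat_real A (X t \<omega>))"
  have meas: "X t \<in> measurable M (count_space UNIV)" if "t \<in> T" for t
    using indep that unfolding indep_vars_def by blast
  have indep_Y: "indep_vars (\<lambda>_. borel) Y T"
    unfolding Y_def by (rule indep_vars_compose2[OF indep]) auto
  have expectation_Y: "expectation (Y t) = measure_pmf.prob p A" if "t \<in> T" for t
  proof -
    have "expectation (Y t) = measure_pmf.expectation p (indicat_real A)"
      unfolding Y_def distr[OF that, symmetric]
      by (rule integral_distr[symmetric]) (use meas[OF that] in auto)
    thus ?thesis by simp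
  qed
  have sum_Y: "(\<Sum>t\<in>T. Y t \<omega>) = real (card {t\<in>T. X t \<omega> \<in> A})" for \<omega>
    using fin by (simp add: Y_def indicator_def sum.If_cases Int_def)
  interpret Hoeffding_ineq M T Y "\<lambda>_. 0" "\<lambda>_. 1" "m * measure_pmf.prob p A"
    by unfold_locales (auto simp: fin indep_Y m_def expectation_Y, auto simp: Y_def indicator_def)
  \<comment> \<open>Hoeffding's inequality concerns the sum; turning the frequency into the sum
    multiplies the threshold by \<open>m\<close>.\<close>
  have scale: "\<epsilon> \<le> \<bar>x / m - q\<bar> \<longleftrightarrow> m * \<epsilon> \<le> \<bar>x - m * q\<bar>" for x q :: real
  proof -
    have "\<bar>x - m * q\<bar> = m * \<bar>x / m - q\<bar>"
      using m by (simp add: abs_mult_pos' right_diff_distrib)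
    thus ?thesis using m by simp
  qed
  have "prob {\<omega>\<in>space M. \<bar>(\<Sum>t\<in>T. Y t \<omega>) - m * measure_pmf.prob p A\<bar> \<ge> m * \<epsilon>}
          \<le> 2 * exp (-2 * (m * \<epsilon>)\<^sup>2 / (\<Sum>t\<in>T. (1 - 0)\<^sup>2))"
    by (rule Hoeffding_ineq_abs_ge) (use m \<open>\<epsilon> \<ge> 0\<close> in \<open>auto simp: m_def\<close>)
  \<comment> \<open>All ranges have width 1, so the denominator is \<open>m\<close> and cancels one
    factor of \<open>m\<^sup>2\<close>.\<close>
  also have "-2 * (m * \<epsilon>)\<^sup>2 / (\<Sum>t\<in>T. (1 - 0)\<^sup>2) = -2 * m * \<epsilon>\<^sup>2"
    using m by (simp add: m_def[symmetric] power2_eq_square)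
  finally show ?thesis
    by (simp only: sum_Y scale m_def[symmetric])
qed

text \<open>The complement is the union of the failure events, and subadditivity copes with
  dependent events, such as memberships of different people in the same random panel.\<close>

lemma prob_Ball_ge_union_bound:
  assumes "finite J" and "\<And>i. i \<in> J \<Longrightarrow> {\<omega>\<in>space M. \<not> P i \<omega>} \<in> events"
    and "\<And>i. i \<in> J \<Longrightarrow> prob {\<omega>\<in>space M. \<not> P i \<omega>} \<le> c"
  shows "prob {\<omega>\<in>space M. \<forall>i\<in>J. P i \<omega>} \<ge> 1 - real (card J) * c"
proof -
  define B where "B = (\<lambda>i. {\<omega>\<in>space M. \<not> P i \<omega>})"
  have B: "B ` J \<subseteq> events"
    using assms(2) by (auto simp: B_def)
  have "prob (\<Union>i\<in>J. B i) \<le> (\<Sum>i\<in>J. prob (B i))"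
    using B by (intro finite_measure_subadditive_finite assms(1))
  also have "\<dots> \<le> real (card J) * c"
    by (rule sum_bounded_above) (use assms(3) in \<open>simp add: B_def\<close>)
  finally have "prob (\<Union>i\<in>J. B i) \<le> real (card J) * c" .
  moreover have "{\<omega>\<in>space M. \<forall>i\<in>J. P i \<omega>} = space M - (\<Union>i\<in>J. B i)"
    by (auto simp: B_def)
  moreover have "(\<Union>i\<in>J. B i) \<in> events"
    using B assms(1) by blast
  ultimately show ?thesis
    by (simp add: prob_compl)
qed

end

theorem proposition5p5:
  fixes I :: "('f, 'v) sortition_instance"
    and lam :: "nat set pmf"
    and m :: nat and \<delta> :: real
    and M :: "'a measure" and X :: "nat \<Rightarrow> 'a \<Rightarrow> nat set"
  assumes "is_sortition_instance I"
    and "panel_distribution I lam"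
    and "m \<ge> 1"
    and "prob_space M"
    and "prob_space.indep_vars M (\<lambda>_. count_space UNIV) X {1..m}"
    and "\<And>t. t \<in> {1..m} \<Longrightarrow> distr M (count_space UNIV) (X t) = measure_pmf lam"
    and "0 < \<delta>" and "\<delta> < 1"
  shows "measure M {\<omega> \<in> space M.
      linf_norm (pool_size I)
        (\<lambda>i. lottery_selection_prob (map (\<lambda>t. X t \<omega>) [1..<Suc m]) i - selection_prob lam i)
      \<le> sqrt ((ln (2 * real (pool_size I)) + ln (inverse \<delta>)) / (2 * real m))} \<ge> 1 - \<delta>"
proof -
  interpret prob_space M by fact
  define n where "n = pool_size I"
  define \<epsilon> where "\<epsilon> = sqrt ((ln (2 * real n) + ln (inverse \<delta>)) / (2 * real m))"
  define P where "P = (\<lambda>i \<omega>. \<bar>real (card {t\<in>{1..m}. X t \<omega> \<in> {S. i \<in> S}}) / real m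
    - measure_pmf.prob lam {S. i \<in> S}\<bar> \<le> \<epsilon>)"
  have n: "n \<ge> 1"
    using assms(1) by (simp add: is_sortition_instance_def n_def)
  \<comment> \<open>Both logarithms have arguments at least 1. Nonnegativity lets squaring undo the
    root in \<open>\<epsilon>\<close>.\<close>
  have arg_nonneg: "ln (2 * real n) + ln (inverse \<delta>) \<ge> 0"
    using n \<open>0 < \<delta>\<close> \<open>\<delta> < 1\<close> by (intro add_nonneg_nonneg ln_ge_zero) (auto simp: one_le_inverse_iff)
  have \<epsilon>: "\<epsilon> \<ge> 0"
    using arg_nonneg by (simp add: \<epsilon>_def)
  have "2 * real m * \<epsilon>\<^sup>2 = ln (2 * real n) + ln (inverse \<delta>)"
    using arg_nonneg \<open>m \<ge> 1\<close> by (simp add: \<epsilon>_def)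
  \<comment> \<open>The 2 in this denominator will cancel the factor 2 of the two-sided tail
    bound.\<close>
  also have "\<dots> = - ln (\<delta> / (2 * real n))"
    using n \<open>0 < \<delta>\<close> by (simp add: ln_div ln_inverse)
  finally have tail: "2 * exp (-2 * real m * \<epsilon>\<^sup>2) = \<delta> / real n"
    using n \<open>0 < \<delta>\<close> by simp
  have meas: "X t \<in> measurable M (count_space UNIV)" if "t \<in> {1..m}" for t
    using assms(5) that unfolding indep_vars_def by blast
  have bad: "{\<omega>\<in>space M. \<not> P i \<omega>} \<in> events \<and> prob {\<omega>\<in>space M. \<not> P i \<omega>} \<le> \<delta> / real n" for i
  proof -
    define q where "q = measure_pmf.prob lam {S. i \<in> S}"
    define F where "F = (\<lambda>\<omega>. real (card {t\<in>{1..m}. X t \<omega> \<in> {S. i \<in> S}}))"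
    have [measurable]: "F \<in> borel_measurable M"
      unfolding F_def by (rule borel_measurable_card_hits) (use meas in auto)
    have P_i: "{\<omega>\<in>space M. \<not> P i \<omega>} = {\<omega>\<in>space M. \<epsilon> < \<bar>F \<omega> / real m - q\<bar>}"
      by (simp only: P_def F_def q_def not_le)
    \<comment> \<open>Failure of the claimed bound is a strict inequality, while the tail bound
      covers the larger non-strict event.\<close>
    have "prob {\<omega>\<in>space M. \<epsilon> < \<bar>F \<omega> / real m - q\<bar>} \<le>
        prob {\<omega>\<in>space M. \<epsilon> \<le> \<bar>F \<omega> / real m - q\<bar>}"
    proof (rule finite_measure_mono)
      show "{\<omega>\<in>space M. \<epsilon> \<le> \<bar>F \<omega> / real m - q\<bar>} \<in> events"
        by measurable
    qed (simp add: Collect_mono)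
    also have "\<dots> \<le> 2 * exp (-2 * real m * \<epsilon>\<^sup>2)"
      using Hoeffding_empirical_frequency[OF _ _ assms(5,6) \<epsilon>, of "{S. i \<in> S}"] \<open>m \<ge> 1\<close>
      unfolding F_def q_def by (simp only: card_atLeastAtMost) simp
    also have "\<dots> = \<delta> / real n"
      by (fact tail)
    moreover have "{\<omega>\<in>space M. \<epsilon> < \<bar>F \<omega> / real m - q\<bar>} \<in> events"
      by measurable
    ultimately show ?thesis
      by (simp only: P_i simp_thms)
  qed
  \<comment> \<open>The \<open>n\<close> failure bounds of \<open>\<delta> / real n\<close> add up
    to exactly \<open>\<delta>\<close>.\<close>
  have "1 - real (card {1..n}) * (\<delta> / real n) \<le> prob {\<omega>\<in>space M. \<forall>i\<in>{1..n}. P i \<omega>}"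
    by (rule prob_Ball_ge_union_bound) (use bad in auto)
  thus ?thesis
    using n
    by (simp add: linf_norm_le_iff lottery_selection_prob_map selection_prob_def P_def
        \<epsilon>_def[symmetric] n_def[symmetric] del: upt_Suc One_nat_def)
qed

end
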